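(* (1) For all $A,B,C\in\widehat{\mathbb{F}_q^\times}$ and $\lambda\in\mathbb{F}_q$, $$\mathbb{P}_D^{(1)}\left[\begin{matrix}A; & B\\ & C\end{matrix};\lambda\right]=AC(-1)\,\overline{B}(-\lambda)\,\mathbb{P}_D^{(1)}\left[\begin{matrix}\overline{C}B; & B\\ & \overline{A}B\end{matrix};\frac1\lambda\right]+\delta(\lambda)\,J(A,C\overline{A}),$$ where for $\lambda=0$ the first term on the right is read as $0$ (since $\overline{B}(0)=0$). (2) Let $n\ge2$. For all $A,C,B_1,\dots,B_n\in\widehat{\mathbb{F}_q^\times}$ and $\lambda_1,\dots,\lambda_n\in\mathbb{F}_q^\times$, $$\mathbb{P}_D^{(n)}\left[\begin{matrix}A; & B_1\ \cdots\ B_n\\ & C\end{matrix};\lambda_1,\dots,\lambda_n\right]=AC(-1)\left(\prod_{i=1}^n\overline{B_i}(-\lambda_i)\right)\mathbb{P}_D^{(n)}\left[\begin{matrix}\overline{C}\prod_{i=1}^nB_i; & B_1\ \cdots\ B_n\\ & \overline{A}\prod_{i=1}^nB_i\end{matrix};\frac1{\lambda_1},\dots,\frac1{\lambda_n}\right].$$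
   Context: $\mathbb{F}_q$ is a finite field with $q=p^e$, $p$ an odd prime. $\widehat{\mathbb{F}_q^\times}$ is the group of complex-valued multiplicative characters of $\mathbb{F}_q^\times$; every character $\chi$, including the trivial one, is extended to $\mathbb{F}_q$ by $\chi(0)=0$, and $\overline{\chi}=\chi^{-1}$. For $x\in\mathbb{F}_q$, $\delta(x)=1$ if $x=0$ and $\delta(x)=0$ otherwise. The Jacobi sum is $J(A,B)=\sum_{x\in\mathbb{F}_q}A(x)B(1-x)$. For $n\ge1$ the finite-field Appell-Lauricella period function is $$\mathbb{P}_D^{(n)}\left[\begin{matrix}A; & B_1\ \cdots\ B_n\\ & C\end{matrix};\lambda_1,\dots,\lambda_n\right]=\sum_{y\in\mathbb{F}_q}A(y)\,C\overline{A}(1-y)\,\overline{B_1}(1-\lambda_1y)\cdots\overline{B_n}(1-\lambda_ny).$$ *)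

theory Defs
  imports Complex_Main "HOL-Computational_Algebra.Primes"
begin

text \<open>
  A multiplicative character is represented by its extension to the whole field, with value 0
  at 0. This also applies to the trivial character, which is therefore not the constant
  function 1.
\<close>

definition mult_chars :: "('a::field \<Rightarrow> complex) set" where
  "mult_chars = {\<chi>. \<chi> 0 = 0 \<and> (\<forall>x. x \<noteq> 0 \<longrightarrow> \<chi> x \<noteq> 0) \<and>
     (\<forall>x y. x \<noteq> 0 \<longrightarrow> y \<noteq> 0 \<longrightarrow> \<chi> (x * y) = \<chi> x * \<chi> y)}"

definition char_one :: "'a::field \<Rightarrow> complex" where
  "char_one x = (if x = 0 then 0 else 1)"

definition char_mult :: "('a::field \<Rightarrow> complex) \<Rightarrow> ('a \<Rightarrow> complex) \<Rightarrow> 'a \<Rightarrow> complex"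
    (infixl "\<odot>" 70) where
  "(A \<odot> B) x = A x * B x"

text \<open>Since \<open>inverse 0 = 0\<close>, the pointwise inverse is again extended by 0.\<close>

definition char_inv :: "('a::field \<Rightarrow> complex) \<Rightarrow> 'a \<Rightarrow> complex" where
  "char_inv \<chi> x = inverse (\<chi> x)"

definition char_prod :: "('i \<Rightarrow> 'a::field \<Rightarrow> complex) \<Rightarrow> 'i set \<Rightarrow> 'a \<Rightarrow> complex" where
  "char_prod B I x = (if x = 0 then 0 else \<Prod>i\<in>I. B i x)"

lemma char_one_mem: "char_one \<in> mult_chars"
  by (auto simp: mult_chars_def char_one_def)

lemma char_mult_mem: "A \<in> mult_chars \<Longrightarrow> B \<in> mult_chars \<Longrightarrow> A \<odot> B \<in> mult_chars"
  by (auto simp: mult_chars_def char_mult_def)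

lemma char_inv_mem: "A \<in> mult_chars \<Longrightarrow> char_inv A \<in> mult_chars"
  by (auto simp: mult_chars_def char_inv_def)

lemma char_mult_inv: "A \<in> mult_chars \<Longrightarrow> A \<odot> char_inv A = char_one"
  by (auto simp: mult_chars_def char_mult_def char_inv_def char_one_def fun_eq_iff)

lemma char_prod_empty: "char_prod B {} = char_one"
  by (auto simp: char_prod_def char_one_def fun_eq_iff)

lemma char_prod_insert:
  "finite I \<Longrightarrow> i \<notin> I \<Longrightarrow> char_prod B (insert i I) = B i \<odot> char_prod B I"
  if "B i \<in> mult_chars"
  using that by (auto simp: char_prod_def char_mult_def mult_chars_def fun_eq_iff)

definition delta :: "'a::zero \<Rightarrow> complex" where
  "delta x = (if x = 0 then 1 else 0)"

definition jacobi_sum ::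
    "('a::{finite,field} \<Rightarrow> complex) \<Rightarrow> ('a \<Rightarrow> complex) \<Rightarrow> complex" where
  "jacobi_sum A B = (\<Sum>x\<in>UNIV. A x * B (1 - x))"

text \<open>
  The families \<open>B\<close> and \<open>l\<close> are indexed by \<open>1, \<dots>, n\<close>; their values elsewhere are irrelevant.
\<close>

definition PD :: "nat \<Rightarrow> ('a::{finite,field} \<Rightarrow> complex) \<Rightarrow> (nat \<Rightarrow> 'a \<Rightarrow> complex)
    \<Rightarrow> ('a \<Rightarrow> complex) \<Rightarrow> (nat \<Rightarrow> 'a) \<Rightarrow> complex" where
  "PD n A B C l =
     (\<Sum>y\<in>UNIV. A y * (C \<odot> char_inv A) (1 - y) * (\<Prod>i=1..n. char_inv (B i) (1 - l i * y)))"

end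

theory Submission
  imports Defs
begin

text \<open>
  Both parts come from the substitution \<open>y \<mapsto> 1/y\<close>, under which
  \<open>1 - 1/y = - (1 - y) / y\<close> and \<open>1 - \<lambda>/y = (- \<lambda>) (1 - y/\<lambda>) / y\<close>;
  the sign \<open>AC(-1)\<close> appears because \<open>A(-1)\<close> is its own inverse.
\<close>

lemma mult_char_zero: "\<chi> \<in> mult_chars \<Longrightarrow> \<chi> 0 = 0"
  by (simp add: mult_chars_def)

lemma mult_char_nonzero: "\<chi> \<in> mult_chars \<Longrightarrow> x \<noteq> 0 \<Longrightarrow> \<chi> x \<noteq> 0"
  by (simp add: mult_chars_def)

text \<open>Because characters take the value 0 at 0, multiplicativity extends to zero arguments, so
  later rewriting needs no side conditions.\<close>

lemma mult_char_mult: "\<chi> \<in> mult_chars \<Longrightarrow> \<chi> (x * y) = \<chi> x * \<chi> y"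
  by (cases "x = 0"; cases "y = 0") (auto simp: mult_chars_def)

lemma mult_char_one:
  assumes "\<chi> \<in> mult_chars"
  shows "\<chi> 1 = 1"
  using mult_char_mult[OF assms, of 1 1] mult_char_nonzero[OF assms, of 1] by simp

lemma mult_char_inverse:
  assumes "\<chi> \<in> mult_chars"
  shows "\<chi> (inverse x) = inverse (\<chi> x)"
proof (cases "x = 0")
  case True
  then show ?thesis using mult_char_zero[OF assms] by simp
next
  case False
  then have "\<chi> x * \<chi> (inverse x) = 1"
    using mult_char_mult[OF assms, of x "inverse x"] mult_char_one[OF assms] by simp
  then show ?thesis by (metis inverse_unique)
qed

lemma mult_char_minus_one:
  assumes "\<chi> \<in> mult_chars"
  shows "inverse (\<chi> (-1)) = \<chi> (-1)"
  using mult_char_inverse[OF assms, of "-1"] by simp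

text \<open>Keeping \<open>n\<close> arbitrary lets one computation serve both parts:
  \<open>n = 1\<close> settles the case of nonzero \<open>l\<close> in the first.\<close>

lemma PD_inversion:
  fixes A C :: "'a::{finite,field} \<Rightarrow> complex"
  assumes A: "A \<in> mult_chars" and C: "C \<in> mult_chars"
    and B: "\<And>i. i \<in> {1..n} \<Longrightarrow> B i \<in> mult_chars"
    and l: "\<And>i. i \<in> {1..n} \<Longrightarrow> l i \<noteq> 0"
  shows "PD n A B C l =
    (A \<odot> C) (-1) * (\<Prod>i=1..n. char_inv (B i) (- l i)) *
      PD n (char_inv C \<odot> char_prod B {1..n}) B (char_inv A \<odot> char_prod B {1..n}) (\<lambda>i. 1 / l i)"
proof -
  let ?P = "char_prod B {1..n}"
  define f where "f y = A y * (C \<odot> char_inv A) (1 - y) *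
      (\<Prod>i=1..n. char_inv (B i) (1 - l i * y))" for y
  define g where "g y = (char_inv C \<odot> ?P) y *
      ((char_inv A \<odot> ?P) \<odot> char_inv (char_inv C \<odot> ?P)) (1 - y) *
      (\<Prod>i=1..n. char_inv (B i) (1 - 1 / l i * y))" for y
  let ?K = "(A \<odot> C) (-1) * (\<Prod>i=1..n. char_inv (B i) (- l i))"
  \<comment> \<open>The summands agree term by term. At \<open>y = 0\<close>, where
    \<open>inverse 0 = 0\<close>, both sides vanish since \<open>A 0 = 0\<close> and
    \<open>C 0 = 0\<close>.\<close>
  have fg: "f (inverse y) = ?K * g y" for y
  proof (cases "y = 0")
    case True
    then show ?thesis
      using mult_char_zero[OF A] mult_char_zero[OF C]
      by (simp add: f_def g_def char_mult_def char_inv_def)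
  next
    case y: False
    have y_eq: "1 - inverse y = -1 * (1 - y) * inverse y"
      using y by (simp add: field_simps)
    have C1: "C (1 - inverse y) = C (-1) * C (1 - y) * inverse (C y)"
      unfolding y_eq mult_char_mult[OF C] mult_char_inverse[OF C] ..
    have A1: "A (1 - inverse y) = A (-1) * A (1 - y) * inverse (A y)"
      unfolding y_eq mult_char_mult[OF A] mult_char_inverse[OF A] ..
    have Ay: "A y \<noteq> 0"
      using mult_char_nonzero[OF A y] .
    \<comment> \<open>The factor \<open>inverse (A y)\<close> from \<open>A (inverse y)\<close>
      cancels the \<open>A y\<close> coming from \<open>char_inv A\<close>, so only
      \<open>char_inv C y\<close> survives.\<close>
    have factors: "A (inverse y) * (C \<odot> char_inv A) (1 - inverse y) =
        (A \<odot> C) (-1) * (char_inv C y * (C \<odot> char_inv A) (1 - y))"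
      using Ay by (simp add: char_mult_def char_inv_def C1 A1 mult_char_inverse[OF A]
          mult_char_minus_one[OF A])
    \<comment> \<open>Dividing by \<open>l i\<close> requires it to be nonzero. The factor
      \<open>inverse y\<close> contributes \<open>B i y\<close>; over all \<open>i\<close> these
      collect into \<open>?P y\<close>.\<close>
    have "char_inv (B i) (1 - l i * inverse y) =
        char_inv (B i) (- l i) * (B i y * char_inv (B i) (1 - 1 / l i * y))"
      if i: "i \<in> {1..n}" for i
    proof -
      have l_eq: "1 - l i * inverse y = - l i * (1 - 1 / l i * y) * inverse y"
        using y l[OF i] by (simp add: field_simps)
      show ?thesis
        unfolding char_inv_def l_eq mult_char_mult[OF B[OF i]] mult_char_inverse[OF B[OF i]]
        by simp
    qed
    then have prods: "(\<Prod>i=1..n. char_inv (B i) (1 - l i * inverse y)) =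
        (\<Prod>i=1..n. char_inv (B i) (- l i)) *
          (?P y * (\<Prod>i=1..n. char_inv (B i) (1 - 1 / l i * y)))"
      using y by (simp add: char_prod_def prod.distrib)
    have "?P (1 - y) \<noteq> 0" if "1 - y \<noteq> 0"
      using that B mult_char_nonzero by (fastforce simp: char_prod_def)
    \<comment> \<open>The two copies of \<open>?P\<close> cancel where \<open>1 - y\<close> is
      nonzero; at \<open>y = 1\<close> both sides are 0.\<close>
    then have third: "((char_inv A \<odot> ?P) \<odot> char_inv (char_inv C \<odot> ?P)) (1 - y) =
        (C \<odot> char_inv A) (1 - y)"
      using mult_char_zero[OF C]
      by (cases "1 - y = 0") (auto simp: char_mult_def char_inv_def char_prod_def)
    show ?thesis
      unfolding f_def g_def third factors prods by (simp add: char_mult_def mult_ac)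
  qed
  have "PD n A B C l = (\<Sum>y\<in>UNIV. f y)"
    by (simp add: PD_def f_def)
  \<comment> \<open>With \<open>inverse 0 = 0\<close>, inversion is an involution of the whole
    field, so 0 need not be split off.\<close>
  also have "\<dots> = (\<Sum>y\<in>UNIV. f (inverse y))"
    by (rule sum.reindex_bij_witness[of _ inverse inverse]) auto
  also have "\<dots> = ?K * (\<Sum>y\<in>UNIV. g y)"
    by (simp add: fg sum_distrib_left)
  also have "(\<Sum>y\<in>UNIV. g y) =
      PD n (char_inv C \<odot> ?P) B (char_inv A \<odot> ?P) (\<lambda>i. 1 / l i)"
    by (simp add: PD_def g_def)
  finally show ?thesis .
qed

lemma PD_1_inversion:
  fixes A B C :: "'a::{finite,field} \<Rightarrow> complex"
  assumes A: "A \<in> mult_chars" and B: "B \<in> mult_chars" and C: "C \<in> mult_chars"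
  shows "PD 1 A (\<lambda>_. B) C (\<lambda>_. l) =
    (A \<odot> C) (-1) * char_inv B (- l) *
      PD 1 (char_inv C \<odot> B) (\<lambda>_. B) (char_inv A \<odot> B) (\<lambda>_. 1 / l)
    + delta l * jacobi_sum A (C \<odot> char_inv A)"
proof (cases "l = 0")
  case True
  \<comment> \<open>For \<open>l = 0\<close> the first term on the right dies because
    \<open>char_inv B 0 = 0\<close>, whatever \<open>1 / 0\<close> means. On the left
    \<open>B 1 = 1\<close> leaves exactly the Jacobi sum.\<close>
  then show ?thesis
    using mult_char_zero[OF B] mult_char_one[OF B]
    by (simp add: PD_def jacobi_sum_def delta_def char_inv_def)
next
  case False
  \<comment> \<open>Agreement at 0 holds because \<open>B 0 = 0\<close> matches the value built into
    \<open>char_prod\<close>.\<close>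
  have "char_prod (\<lambda>_::nat. B) {1..1} = B"
    using mult_char_zero[OF B] by (auto simp: char_prod_def fun_eq_iff)
  then show ?thesis
    using PD_inversion[OF A C, of 1 "\<lambda>_. B" "\<lambda>_. l"] B False by (simp add: delta_def)
qed

theorem proposition6p4:
  fixes p e :: nat
  assumes "prime p" and "odd p" and "card (UNIV :: 'a::{finite,field} set) = p ^ e"
  shows
    "(\<forall>A B C :: 'a \<Rightarrow> complex. \<forall>l :: 'a.
        A \<in> mult_chars \<longrightarrow> B \<in> mult_chars \<longrightarrow> C \<in> mult_chars \<longrightarrow>
        PD 1 A (\<lambda>_. B) C (\<lambda>_. l) =
          (A \<odot> C) (-1) * char_inv B (- l) *
            PD 1 (char_inv C \<odot> B) (\<lambda>_. B) (char_inv A \<odot> B) (\<lambda>_. 1 / l)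
          + delta l * jacobi_sum A (C \<odot> char_inv A))
     \<and>
     (\<forall>n \<ge> 2. \<forall>(A :: 'a \<Rightarrow> complex) C. \<forall>(B :: nat \<Rightarrow> 'a \<Rightarrow> complex). \<forall>(l :: nat \<Rightarrow> 'a).
        A \<in> mult_chars \<longrightarrow> C \<in> mult_chars \<longrightarrow>
        (\<forall>i\<in>{1..n}. B i \<in> mult_chars) \<longrightarrow> (\<forall>i\<in>{1..n}. l i \<noteq> 0) \<longrightarrow>
        PD n A B C l =
          (A \<odot> C) (-1) * (\<Prod>i=1..n. char_inv (B i) (- l i)) *
            PD n (char_inv C \<odot> char_prod B {1..n}) B (char_inv A \<odot> char_prod B {1..n})
              (\<lambda>i. 1 / l i))"
proof (intro conjI allI impI, goal_cases)
  case 1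
  then show ?case by (rule PD_1_inversion)
next
  case 2
  then show ?case by (intro PD_inversion) auto
qed

end
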